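(* Let $\mathcal{X}\subseteq\mathbb{R}^n$ be closed and convex, let $f:\mathcal{X}\to\mathbb{R}$ be a continuously differentiable convex function that is $L$-smooth with respect to a norm $\|\cdot\|$ and has a minimizer $\mathbf{x}_*\in\arg\min_{\mathbf{x}\in\mathcal{X}}f(\mathbf{x})$, and let $\mathbf{x}_0\in\mathcal{X}$ be an arbitrary initial point. Suppose the sequences $\mathbf{x}_k,\mathbf{y}_k,\mathbf{z}_k$ evolve according to the AGD+ algorithm (defined in the context) for some differentiable function $\psi:\mathcal{X}\to\mathbb{R}$ that is $\mu$-strongly convex with respect to $\|\cdot\|$ ($\mu>0$), where the oracle errors $\boldsymbol{\eta}_k$ are zero-mean independent random vectors and $\frac{a_k^2}{A_k}\le\frac{\mu}{L}$ for all $k\ge1$. Then for all $k\ge1$: $$\mathbb{E}[f(\mathbf{y}_k)-f(\mathbf{x}_* )]\le\frac{D_\psi(\mathbf{x}_*,\mathbf{x}_0)}{A_k}+\frac{\sum_{i=1}^k a_i^2\,\mathbb{E}[\|\boldsymbol{\eta}_i\|_*^2]}{\mu A_k}.$$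
   Context: $\|\cdot\|$ is an arbitrary fixed norm on $\mathbb{R}^n$, with dual norm $\|\mathbf{z}\|_*=\sup\{\langle\mathbf{z},\mathbf{x}\rangle:\|\mathbf{x}\|=1\}$. $f$ is $L$-smooth ($L>0$) on $\mathcal{X}$ if $f(\hat{\mathbf{x}})\le f(\mathbf{x})+\langle\nabla f(\mathbf{x}),\hat{\mathbf{x}}-\mathbf{x}\rangle+\frac{L}{2}\|\hat{\mathbf{x}}-\mathbf{x}\|^2$ for all $\mathbf{x},\hat{\mathbf{x}}\in\mathcal{X}$. $\psi$ is $\mu$-strongly convex on $\mathcal{X}$ if $\psi(\hat{\mathbf{x}})\ge \psi(\mathbf{x})+\langle\nabla \psi(\mathbf{x}),\hat{\mathbf{x}}-\mathbf{x}\rangle+\frac{\mu}{2}\|\hat{\mathbf{x}}-\mathbf{x}\|^2$ for all $\mathbf{x},\hat{\mathbf{x}}\in\mathcal{X}$. Bregman divergence: $D_\psi(\mathbf{x},\hat{\mathbf{x}})=\psi(\mathbf{x})-\psi(\hat{\mathbf{x}})-\langle\nabla\psi(\hat{\mathbf{x}}),\mathbf{x}-\hat{\mathbf{x}}\rangle$. Convex conjugate: $\psi^*(\mathbf{z})=\max_{\mathbf{x}\in\mathcal{X}}\{\langle\mathbf{z},\mathbf{x}\rangle-\psi(\mathbf{x})\}$, so that $\nabla\psi^*(\mathbf{z})=\arg\max_{\mathbf{x}\in\mathcal{X}}\{\langle\mathbf{z},\mathbf{x}\rangle-\psi(\mathbf{x})\}$. AGD+ algorithm: let $a_k>0$ ($k\ge1$)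 be deterministic, $A_k=\sum_{i=1}^k a_i$, $A_0=0$. A gradient oracle queried at $\mathbf{x}_k$ returns $\widetilde{\nabla}f(\mathbf{x}_k)=\nabla f(\mathbf{x}_k)+\boldsymbol{\eta}_k$, where $\boldsymbol{\eta}_k$ is the additive error. Initialize $\mathbf{z}_0=\nabla\psi(\mathbf{x}_0)$, and set $\mathbf{x}_1=\mathbf{x}_0$, $\mathbf{z}_1=\mathbf{z}_0-a_1\widetilde{\nabla}f(\mathbf{x}_1)$, $\mathbf{y}_1=\nabla\psi^*(\mathbf{z}_1)$. For $k\ge2$: $$\mathbf{x}_k=\tfrac{A_{k-1}}{A_k}\mathbf{y}_{k-1}+\tfrac{a_k}{A_k}\nabla\psi^*(\mathbf{z}_{k-1}),\quad \mathbf{z}_k=\mathbf{z}_{k-1}-a_k\widetilde{\nabla}f(\mathbf{x}_k),\quad \mathbf{y}_k=\tfrac{A_{k-1}}{A_k}\mathbf{y}_{k-1}+\tfrac{a_k}{A_k}\nabla\psi^*(\mathbf{z}_k).$$ *)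

theory Defs
  imports "HOL-Probability.Probability"
begin

definition is_norm :: "('a::real_vector \<Rightarrow> real) \<Rightarrow> bool" where
  "is_norm N \<longleftrightarrow>
     (\<forall>x. N x = 0 \<longleftrightarrow> x = 0) \<and>
     (\<forall>c x. N (c *\<^sub>R x) = \<bar>c\<bar> * N x) \<and>
     (\<forall>x y. N (x + y) \<le> N x + N y)"

definition dual_norm :: "('a::real_inner \<Rightarrow> real) \<Rightarrow> 'a \<Rightarrow> real" where
  "dual_norm N z = (SUP x\<in>{x. N x = 1}. z \<bullet> x)"

text \<open>
  A function on a closed convex set \<open>X\<close> is represented by a total function of which only the
  values on \<open>X\<close> matter, so differentiability is taken within \<open>X\<close>. The gradient \<open>G\<close> is
  unique on \<open>X\<close> when \<open>X\<close> has nonempty interior; otherwise \<open>G\<close> is a choice of gradient. It is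
  passed explicitly to the notions below that mention it.
\<close>
definition has_gradient_on ::
    "'a::real_inner set \<Rightarrow> ('a \<Rightarrow> real) \<Rightarrow> ('a \<Rightarrow> 'a) \<Rightarrow> bool" where
  "has_gradient_on X F G \<longleftrightarrow>
     (\<forall>x\<in>X. (F has_derivative (\<lambda>h. G x \<bullet> h)) (at x within X))"

definition L_smooth_on ::
    "'a::real_inner set \<Rightarrow> ('a \<Rightarrow> real) \<Rightarrow> real \<Rightarrow> ('a \<Rightarrow> real) \<Rightarrow> ('a \<Rightarrow> 'a) \<Rightarrow> bool" where
  "L_smooth_on X N L f gf \<longleftrightarrow>
     (\<forall>x\<in>X. \<forall>x'\<in>X. f x' \<le> f x + gf x \<bullet> (x' - x) + L / 2 * (N (x' - x))\<^sup>2)"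

definition strongly_convex_on ::
    "'a::real_inner set \<Rightarrow> ('a \<Rightarrow> real) \<Rightarrow> real \<Rightarrow> ('a \<Rightarrow> real) \<Rightarrow> ('a \<Rightarrow> 'a) \<Rightarrow> bool" where
  "strongly_convex_on X N \<mu> \<psi> g\<psi> \<longleftrightarrow>
     (\<forall>x\<in>X. \<forall>x'\<in>X. \<psi> x' \<ge> \<psi> x + g\<psi> x \<bullet> (x' - x) + \<mu> / 2 * (N (x' - x))\<^sup>2)"

definition bregman :: "('a::real_inner \<Rightarrow> real) \<Rightarrow> ('a \<Rightarrow> 'a) \<Rightarrow> 'a \<Rightarrow> 'a \<Rightarrow> real" where
  "bregman \<psi> g\<psi> x x' = \<psi> x - \<psi> x' - g\<psi> x' \<bullet> (x - x')"

text \<open>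
  For a closed convex \<open>X\<close> and a differentiable, strongly convex \<open>\<psi>\<close> the supremum is a
  maximum, attained at exactly one point, and this point is the gradient of the conjugate.
\<close>
definition convex_conjugate :: "'a::real_inner set \<Rightarrow> ('a \<Rightarrow> real) \<Rightarrow> 'a \<Rightarrow> real" where
  "convex_conjugate X \<psi> z = (SUP x\<in>X. z \<bullet> x - \<psi> x)"

definition gradient :: "('a::real_inner \<Rightarrow> real) \<Rightarrow> 'a \<Rightarrow> 'a" where
  "gradient F z = (THE g. GDERIV F z :> g)"

definition A_sum :: "(nat \<Rightarrow> real) \<Rightarrow> nat \<Rightarrow> real" where
  "A_sum a k = (\<Sum>i=1..k. a i)"

text \<open>
  One run of AGD+ with step weights \<open>a\<close> and realised oracle errors \<open>\<eta>\<close>; \<open>y 0\<close>, \<open>a 0\<close> and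
  \<open>\<eta> 0\<close> play no role.
\<close>
definition agd_plus ::
    "'a::real_inner set \<Rightarrow> ('a \<Rightarrow> 'a) \<Rightarrow> ('a \<Rightarrow> real) \<Rightarrow> ('a \<Rightarrow> 'a) \<Rightarrow> (nat \<Rightarrow> real) \<Rightarrow> 'a \<Rightarrow>
     (nat \<Rightarrow> 'a) \<Rightarrow> (nat \<Rightarrow> 'a) \<Rightarrow> (nat \<Rightarrow> 'a) \<Rightarrow> (nat \<Rightarrow> 'a) \<Rightarrow> bool" where
  "agd_plus X gf \<psi> g\<psi> a x0 \<eta> x y z \<longleftrightarrow>
     (let A = A_sum a; mirror = gradient (convex_conjugate X \<psi>); oracle = (\<lambda>k. gf (x k) + \<eta> k) in
       x 0 = x0 \<and> z 0 = g\<psi> x0 \<and>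
       x 1 = x0 \<and> z 1 = z 0 - a 1 *\<^sub>R oracle 1 \<and> y 1 = mirror (z 1) \<and>
       (\<forall>k\<ge>2.
          x k = (A (k - 1) / A k) *\<^sub>R y (k - 1) + (a k / A k) *\<^sub>R mirror (z (k - 1)) \<and>
          z k = z (k - 1) - a k *\<^sub>R oracle k \<and>
          y k = (A (k - 1) / A k) *\<^sub>R y (k - 1) + (a k / A k) *\<^sub>R mirror (z k)))"

end

theory Submission
  imports Defs
begin

text \<open>
  The potential \<open>P\<^sub>k = A\<^sub>k (f y\<^sub>k - f x\<^sub>*) + \<psi>\<^sup>* z\<^sub>k - \<langle>z\<^sub>k, x\<^sub>*\<rangle> + \<psi> x\<^sub>*\<close> starts at the Bregman
  divergence and, by smoothness, convexity and strong convexity, grows in step \<open>k\<close> by at most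
  \<open>- a\<^sub>k \<langle>\<eta>\<^sub>k, v\<^sub>k - x\<^sub>*\<rangle>\<close>, where \<open>v\<^sub>k = \<nabla>\<psi>\<^sup>* z\<^sub>k\<close>. Replace \<open>v\<^sub>k\<close> by the point \<open>w\<^sub>k\<close> that the step would
  reach if \<open>\<eta>\<^sub>k\<close> were zero: since \<open>\<nabla>\<psi>\<^sup>*\<close> is \<open>1/\<mu>\<close>-Lipschitz this costs \<open>a\<^sub>k\<^sup>2 \<parallel>\<eta>\<^sub>k\<parallel>\<^sub>*\<^sup>2 / \<mu>\<close>, and
  \<open>\<langle>\<eta>\<^sub>k, w\<^sub>k - x\<^sub>*\<rangle>\<close> has mean zero because \<open>w\<^sub>k\<close> depends on earlier errors only. Integrability of
  \<open>w\<^sub>k\<close> needs no growth bound on the gradient of \<open>f\<close>: the noise-free step does not increase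
  the potential, which dominates \<open>\<mu>/2 \<parallel>w\<^sub>k - x\<^sub>*\<parallel>\<^sup>2\<close>.
\<close>

section \<open>Norms on a Euclidean space and their duals\<close>

locale norm_on =
  fixes N :: "'a::euclidean_space \<Rightarrow> real"
  assumes is_norm: "is_norm N"
begin

lemma N_eq_0_iff [simp]: "N x = 0 \<longleftrightarrow> x = 0"
  and N_scale: "N (c *\<^sub>R x) = \<bar>c\<bar> * N x"
  and N_triangle: "N (x + y) \<le> N x + N y"
  using is_norm by (auto simp: is_norm_def)

lemma N_zero [simp]: "N 0 = 0"
  using is_norm by (simp add: is_norm_def)

lemma N_minus [simp]: "N (- x) = N x"
  using N_scale[of "-1" x] by simp

lemma N_minus_commute: "N (x - y) = N (y - x)"
  using N_minus[of "x - y"] by simp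

lemma N_nonneg [simp]: "0 \<le> N x"
  using N_triangle[of x "- x"] by simp

lemma N_sum_le: "N (sum g S) \<le> (\<Sum>i\<in>S. N (g i))" if "finite S"
  using that
proof (induction S)
  case (insert i S)
  then show ?case
    using N_triangle[of "g i" "sum g S"] by simp
qed simp

text \<open>Expanding in the standard basis bounds \<open>N\<close> by a multiple of the Euclidean
  norm; the reverse triangle inequality then makes \<open>N\<close> Lipschitz.\<close>

lemma continuous_on_N [continuous_intros]: "continuous_on S N"
proof -
  define B where "B = (\<Sum>b\<in>Basis. N b)"
  have upper: "N x \<le> B * norm x" for x
  proof -
    have "N x = N (\<Sum>b\<in>Basis. (x \<bullet> b) *\<^sub>R b)"
      by (simp add: euclidean_representation)
    also have "\<dots> \<le> (\<Sum>b\<in>Basis. \<bar>x \<bullet> b\<bar> * N b)"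
      using N_sum_le[of Basis "\<lambda>b. (x \<bullet> b) *\<^sub>R b"] by (simp add: N_scale)
    also have "\<dots> \<le> (\<Sum>b\<in>Basis. norm x * N b)"
      by (intro sum_mono mult_right_mono) (auto simp: Basis_le_norm)
    finally show ?thesis
      by (simp add: B_def sum_distrib_left mult.commute)
  qed
  have B0: "B \<ge> 0"
    unfolding B_def by (intro sum_nonneg) simp
  have "\<bar>N x - N y\<bar> \<le> B * norm (x - y)" for x y
    using N_triangle[of "x - y" y] N_triangle[of "y - x" x] upper[of "x - y"]
      N_minus_commute[of x y] by simp
  then have "B-lipschitz_on S N"
    using B0 by (intro lipschitz_onI) (auto simp: dist_norm)
  then show ?thesis
    by (rule lipschitz_on_continuous_on)
qed

text \<open>By compactness \<open>N\<close> attains its minimum on the Euclidean unit sphere. The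
  minimum is positive because \<open>N\<close> vanishes only at 0, and homogeneity extends the bound
  to all vectors.\<close>

lemma norm_equiv: "\<exists>C>0. \<forall>x. norm x \<le> C * N x"
proof -
  obtain b :: 'a where "b \<in> Basis"
    using nonempty_Basis by blast
  then have "sphere (0::'a) 1 \<noteq> {}"
    by (auto simp: norm_Basis intro!: exI[of _ b])
  then obtain m where m: "norm m = 1" "\<And>x. norm x = 1 \<Longrightarrow> N m \<le> N x"
    using continuous_attains_inf[OF compact_sphere _ continuous_on_N, of 0 1] by auto
  have pos: "N m > 0"
    using m(1) N_nonneg[of m] N_eq_0_iff[of m] by (metis less_le norm_zero zero_neq_one)
  have "norm x \<le> 1 / N m * N x" for x
  proof (cases "x = 0")
    case False
    have "N m \<le> N ((1 / norm x) *\<^sub>R x)"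
      using False by (intro m(2)) simp
    then show ?thesis
      using False pos by (simp add: N_scale field_simps)
  qed simp
  with pos show ?thesis
    by (intro exI[of _ "1 / N m"]) simp
qed

definition "equiv_const = (SOME C. C > 0 \<and> (\<forall>x. norm x \<le> C * N x))"

lemma equiv_const_pos: "equiv_const > 0"
  and norm_le_equiv_const: "norm x \<le> equiv_const * N x"
proof -
  have "equiv_const > 0 \<and> (\<forall>x. norm x \<le> equiv_const * N x)"
    unfolding equiv_const_def using norm_equiv by (rule someI_ex)
  then show "equiv_const > 0" "norm x \<le> equiv_const * N x"
    by auto
qed

lemma unit_sphere_nonempty: "{x. N x = 1} \<noteq> {}"
proof -
  obtain b :: 'a where "b \<in> Basis"
    using nonempty_Basis by blast
  then have "N b \<noteq> 0"
    using nonzero_Basis by simp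
  then have "N ((1 / N b) *\<^sub>R b) = 1"
    by (simp add: N_scale)
  then show ?thesis
    by blast
qed

lemma inner_le_on_unit_sphere: "z \<bullet> x \<le> equiv_const * norm z" if "N x = 1"
proof -
  have "z \<bullet> x \<le> norm z * norm x"
    by (rule norm_cauchy_schwarz)
  also have "\<dots> \<le> norm z * equiv_const"
    using norm_le_equiv_const[of x] that by (intro mult_left_mono) auto
  finally show ?thesis
    by (simp add: mult.commute)
qed

lemma bdd_above_dual: "bdd_above ((\<lambda>x. z \<bullet> x) ` {x. N x = 1})"
  by (intro bdd_aboveI2[where M = "equiv_const * norm z"]) (simp add: inner_le_on_unit_sphere)

lemma dual_norm_le: "dual_norm N z \<le> equiv_const * norm z"
  unfolding dual_norm_def
  by (intro cSUP_least unit_sphere_nonempty) (simp add: inner_le_on_unit_sphere)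

lemma dual_norm_add: "dual_norm N (w + z) \<le> dual_norm N w + dual_norm N z"
  unfolding dual_norm_def
  by (rule cSUP_least[OF unit_sphere_nonempty])
    (auto simp: inner_add_left intro!: add_mono cSUP_upper bdd_above_dual)

text \<open>Rescaling a nonzero \<open>x\<close> to the unit sphere of \<open>N\<close> makes it a
  competitor in the supremum that defines the dual norm.\<close>

lemma inner_le_dual_norm: "z \<bullet> x \<le> dual_norm N z * N x"
proof (cases "x = 0")
  case False
  then have pos: "N x > 0"
    by (simp add: order_less_le)
  have "z \<bullet> ((1 / N x) *\<^sub>R x) \<le> dual_norm N z"
    unfolding dual_norm_def using pos
    by (intro cSUP_upper bdd_above_dual) (use False in \<open>simp add: N_scale\<close>)
  then show ?thesis
    using pos by (simp add: field_simps)
qed simp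

lemma dual_norm_scale_le: "dual_norm N (c *\<^sub>R z) \<le> c * dual_norm N z" if "c \<ge> 0"
  unfolding dual_norm_def
  by (rule cSUP_least[OF unit_sphere_nonempty])
    (use that in \<open>auto intro!: mult_left_mono cSUP_upper bdd_above_dual\<close>)

text \<open>The unit sphere is symmetric, so the supremum dominates a number and its
  negative.\<close>

lemma dual_norm_nonneg: "0 \<le> dual_norm N z"
proof -
  obtain x where x: "N x = 1"
    using unit_sphere_nonempty by blast
  show ?thesis
    using inner_le_dual_norm[of z x] inner_le_dual_norm[of z "- x"] x by simp
qed

lemma continuous_on_dual_norm: "continuous_on S (dual_norm N)"
proof -
  have "\<bar>dual_norm N w - dual_norm N z\<bar> \<le> equiv_const * norm (w - z)" for w z
    using dual_norm_add[of "w - z" z] dual_norm_add[of "z - w" w] dual_norm_le[of "w - z"]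
      dual_norm_le[of "z - w"] by (simp add: N_minus_commute norm_minus_commute)
  then have "equiv_const-lipschitz_on S (dual_norm N)"
    using equiv_const_pos by (intro lipschitz_onI) (auto simp: dist_norm)
  then show ?thesis
    by (rule lipschitz_on_continuous_on)
qed

lemma borel_measurable_dual_norm [measurable]: "dual_norm N \<in> borel_measurable borel"
  by (intro borel_measurable_continuous_onI continuous_on_dual_norm)

end

section \<open>First-order conditions and the mirror map\<close>

text \<open>The derivative exists only within \<open>X\<close>, so it is taken one-sidedly along the
  segment from \<open>u\<close> to \<open>v\<close>, where every difference quotient is at most
  \<open>c\<close>. With \<open>c = F v - F u\<close> this yields the gradient inequality for convex
  functions, with \<open>c = 0\<close> the optimality condition at a maximizer.\<close>

lemma gradient_on_inner_le:
  assumes grad: "has_gradient_on X F G" and "convex X" "u \<in> X" "v \<in> X"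
    and le: "\<And>t. 0 < t \<Longrightarrow> t < 1 \<Longrightarrow> F (u + t *\<^sub>R (v - u)) \<le> F u + t * c"
  shows "G u \<bullet> (v - u) \<le> c"
proof -
  define p where "p = (\<lambda>t::real. u + t *\<^sub>R (v - u))"
  have inX: "p t \<in> X" if "t \<in> {0..1}" for t
    using that \<open>convex X\<close> \<open>u \<in> X\<close> \<open>v \<in> X\<close>
    using convexD_alt[of X u v t] by (simp add: p_def algebra_simps)
  have F': "(F has_derivative (\<lambda>h. G u \<bullet> h)) (at (p 0) within p ` {0..1})"
    using grad \<open>u \<in> X\<close> inX unfolding has_gradient_on_def
    by (auto simp: p_def intro: has_derivative_subset)
  have p': "(p has_derivative (\<lambda>t. t *\<^sub>R (v - u))) (at 0 within {0..1})"
    unfolding p_def by (auto intro!: derivative_eq_intros)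
  have "((\<lambda>t. F (p t)) has_derivative (\<lambda>t. G u \<bullet> (t *\<^sub>R (v - u)))) (at 0 within {0..1})"
    by (rule has_derivative_in_compose[OF p' F'])
  moreover have "(\<lambda>t. G u \<bullet> (t *\<^sub>R (v - u))) = (*) (G u \<bullet> (v - u))"
    by (auto simp: mult.commute)
  ultimately have "((\<lambda>t. F (p t)) has_field_derivative (G u \<bullet> (v - u))) (at 0 within {0..1})"
    by (simp only: has_field_derivative_def)
  then have lim: "((\<lambda>t. (F (p t) - F u) / t) \<longlongrightarrow> G u \<bullet> (v - u)) (at 0 within {0..1})"
    by (simp add: has_field_derivative_iff p_def)
  have "\<forall>\<^sub>F t in at 0 within {0..1}. (F (p t) - F u) / t \<le> c"
    unfolding eventually_at
    by (rule exI[of _ "1::real"]) (use le in \<open>auto simp: p_def field_simps dist_real_def\<close>)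
  \<comment> \<open>0 is a limit point of the parameter interval, so the bound passes to the
    limit.\<close>
  moreover have "at (0::real) within {0..1} \<noteq> bot"
    by (simp add: trivial_limit_within islimpt_Icc)
  ultimately show ?thesis
    using tendsto_upperbound[OF lim] by blast
qed

lemma convex_on_gradient_le:
  assumes "has_gradient_on X F G" "convex_on X F" "u \<in> X" "v \<in> X"
  shows "F u + G u \<bullet> (v - u) \<le> F v"
proof -
  have "G u \<bullet> (v - u) \<le> F v - F u"
  proof (rule gradient_on_inner_le[OF assms(1) _ assms(3,4)])
    show "convex X"
      using assms(2) by (rule convex_on_imp_convex)
  next
    fix t :: real
    assume t: "0 < t" "t < 1"
    then have "F ((1 - t) *\<^sub>R u + t *\<^sub>R v) \<le> (1 - t) * F u + t * F v"
      using assms by (intro convex_onD[OF assms(2)]) auto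
    then show "F (u + t *\<^sub>R (v - u)) \<le> F u + t * (F v - F u)"
      by (simp add: algebra_simps)
  qed
  then show ?thesis
    by simp
qed

lemma has_gradient_on_imp_continuous_on: "has_gradient_on X F G \<Longrightarrow> continuous_on X F"
  unfolding has_gradient_on_def continuous_on_eq_continuous_within
  by (blast intro: has_derivative_continuous)

section \<open>The conjugate of a strongly convex function and its gradient\<close>

locale mirror_setup = norm_on N
  for N :: "'a::euclidean_space \<Rightarrow> real" +
  fixes X :: "'a set" and \<psi> :: "'a \<Rightarrow> real" and g\<psi> :: "'a \<Rightarrow> 'a" and \<mu> :: real
  assumes closed_X: "closed X" and convex_X: "convex X" and nonempty_X: "X \<noteq> {}"
    and gradient_\<psi>: "has_gradient_on X \<psi> g\<psi>"
    and \<mu>_pos: "\<mu> > 0"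
    and strongly_convex_\<psi>: "strongly_convex_on X N \<mu> \<psi> g\<psi>"
begin

abbreviation "conjugate \<equiv> convex_conjugate X \<psi>"
abbreviation "mirror_map \<equiv> gradient conjugate"

lemma strongly_convexD:
  "u \<in> X \<Longrightarrow> v \<in> X \<Longrightarrow> \<psi> u + g\<psi> u \<bullet> (v - u) + \<mu> / 2 * (N (v - u))\<^sup>2 \<le> \<psi> v"
  using strongly_convex_\<psi> by (auto simp: strongly_convex_on_def)

text \<open>Maximality of \<open>u\<close> is strengthened by the quadratic growth that strong
  convexity provides; uniqueness, the Lipschitz bound and the progress estimate are all read off
  from this margin.\<close>

definition is_mirror_point :: "'a \<Rightarrow> 'a \<Rightarrow> bool" where
  "is_mirror_point z u \<longleftrightarrow>
     u \<in> X \<and> (\<forall>v\<in>X. z \<bullet> v - \<psi> v + \<mu> / 2 * (N (v - u))\<^sup>2 \<le> z \<bullet> u - \<psi> u)"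

lemma is_mirror_pointI:
  assumes "u \<in> X" "\<And>v. v \<in> X \<Longrightarrow> z \<bullet> (v - u) \<le> g\<psi> u \<bullet> (v - u)"
  shows "is_mirror_point z u"
  unfolding is_mirror_point_def
proof (intro conjI ballI)
  fix v assume "v \<in> X"
  then show "z \<bullet> v - \<psi> v + \<mu> / 2 * (N (v - u))\<^sup>2 \<le> z \<bullet> u - \<psi> u"
    using strongly_convexD[of u v] assms(2)[of v] assms(1) by (simp add: inner_diff_right)
qed fact

text \<open>The objective cannot increase along segments from \<open>u\<close>, which gives the
  variational inequality; strong convexity then supplies the quadratic margin.\<close>

lemma maximizer_is_mirror_point:
  assumes "u \<in> X" "\<And>v. v \<in> X \<Longrightarrow> z \<bullet> v - \<psi> v \<le> z \<bullet> u - \<psi> u"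
  shows "is_mirror_point z u"
proof (rule is_mirror_pointI)
  fix v assume v: "v \<in> X"
  have grad: "has_gradient_on X (\<lambda>x. z \<bullet> x - \<psi> x) (\<lambda>x. z - g\<psi> x)"
    using gradient_\<psi> unfolding has_gradient_on_def
    by (auto intro!: derivative_eq_intros simp: inner_diff_left)
  have "(z - g\<psi> u) \<bullet> (v - u) \<le> 0"
  proof (rule gradient_on_inner_le[OF grad convex_X assms(1) v])
    fix t :: real assume "0 < t" "t < 1"
    then have "(1 - t) *\<^sub>R u + t *\<^sub>R v \<in> X"
      using convexD_alt[OF convex_X assms(1) v] by simp
    then have "u + t *\<^sub>R (v - u) \<in> X"
      by (simp add: algebra_simps)
    from assms(2)[OF this]
    show "z \<bullet> (u + t *\<^sub>R (v - u)) - \<psi> (u + t *\<^sub>R (v - u)) \<le> z \<bullet> u - \<psi> u + t * 0"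
      by simp
  qed
  then show "z \<bullet> (v - u) \<le> g\<psi> u \<bullet> (v - u)"
    by (simp add: inner_diff_left)
qed fact

text \<open>\<open>X\<close> may be unbounded, so a maximizer is first found on a compact piece
  around a point \<open>w\<close>; outside it quadratic growth beats the linear term and the
  objective does not exceed its value at \<open>w\<close>.\<close>

lemma ex_mirror_point: "\<exists>u. is_mirror_point z u"
proof -
  obtain w where w: "w \<in> X"
    using nonempty_X by blast
  \<comment> \<open>Beyond \<open>N\<close>-distance \<open>r\<close> from \<open>w\<close>, the
    term \<mu>/2 times the squared distance outweighs the dual norm times the distance. The factor
    \<open>equiv_const\<close> turns \<open>r\<close> into a Euclidean radius.\<close>
  define r where "r = 2 * dual_norm N (z - g\<psi> w) / \<mu>"
  define S where "S = X \<inter> cball w (equiv_const * r)"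
  have "compact S"
    unfolding S_def using closed_X by (simp add: closed_Int_compact)
  moreover have "w \<in> S"
    unfolding S_def r_def using w \<mu>_pos equiv_const_pos dual_norm_nonneg by simp
  moreover have "continuous_on S (\<lambda>x. z \<bullet> x - \<psi> x)"
    using has_gradient_on_imp_continuous_on[OF gradient_\<psi>]
    by (intro continuous_intros) (auto simp: S_def intro: continuous_on_subset)
  ultimately obtain u where u: "u \<in> S" "\<And>v. v \<in> S \<Longrightarrow> z \<bullet> v - \<psi> v \<le> z \<bullet> u - \<psi> u"
    using continuous_attains_sup[of S "\<lambda>x. z \<bullet> x - \<psi> x"] by blast
  have "z \<bullet> v - \<psi> v \<le> z \<bullet> u - \<psi> u" if v: "v \<in> X" for v
  proof (cases "v \<in> S")
    case False
    then have "equiv_const * r < norm (v - w)"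
      using v by (auto simp: S_def dist_norm norm_minus_commute)
    also have "\<dots> \<le> equiv_const * N (v - w)"
      by (rule norm_le_equiv_const)
    finally have "r < N (v - w)"
      using equiv_const_pos by simp
    then have "dual_norm N (z - g\<psi> w) \<le> \<mu> / 2 * N (v - w)"
      using \<mu>_pos by (simp add: r_def field_simps)
    then have "dual_norm N (z - g\<psi> w) * N (v - w) \<le> \<mu> / 2 * (N (v - w))\<^sup>2"
      unfolding power2_eq_square by (metis mult.assoc mult_right_mono N_nonneg)
    then have "z \<bullet> v - \<psi> v \<le> z \<bullet> w - \<psi> w"
      using inner_le_dual_norm[of "z - g\<psi> w" "v - w"] strongly_convexD[OF w v]
      by (simp add: inner_diff_left inner_diff_right)
    also have "\<dots> \<le> z \<bullet> u - \<psi> u"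
      using u(2) \<open>w \<in> S\<close> by blast
    finally show ?thesis .
  qed (use u in blast)
  then show ?thesis
    using maximizer_is_mirror_point[of u z] u(1) by (auto simp: S_def)
qed

lemma conj_eq: "conjugate z = z \<bullet> u - \<psi> u" if "is_mirror_point z u"
  unfolding convex_conjugate_def
proof (rule cSup_eq_maximum)
  show "z \<bullet> u - \<psi> u \<in> (\<lambda>x. z \<bullet> x - \<psi> x) ` X"
    using that by (auto simp: is_mirror_point_def)
next
  fix s assume "s \<in> (\<lambda>x. z \<bullet> x - \<psi> x) ` X"
  then obtain v where v: "v \<in> X" "s = z \<bullet> v - \<psi> v"
    by blast
  have "0 \<le> \<mu> / 2 * (N (v - u))\<^sup>2"
    using \<mu>_pos by simp
  then show "s \<le> z \<bullet> u - \<psi> u"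
    using that v unfolding is_mirror_point_def by fastforce
qed

text \<open>Testing each growth inequality at the other point and adding cancels \<psi> and leaves
  strong monotonicity; a factor \<open>N (u' - u)\<close> is then divided out.\<close>

lemma mirror_point_lipschitz:
  assumes "is_mirror_point z u" "is_mirror_point z' u'"
  shows "\<mu> * N (u' - u) \<le> dual_norm N (z' - z)"
proof (cases "u' = u")
  case False
  then have pos: "N (u' - u) > 0"
    by (simp add: order_less_le)
  have "z \<bullet> u' - \<psi> u' + \<mu> / 2 * (N (u' - u))\<^sup>2 \<le> z \<bullet> u - \<psi> u"
    "z' \<bullet> u - \<psi> u + \<mu> / 2 * (N (u' - u))\<^sup>2 \<le> z' \<bullet> u' - \<psi> u'"
    using assms N_minus_commute[of u u'] by (auto simp: is_mirror_point_def)
  then have "\<mu> * (N (u' - u))\<^sup>2 \<le> (z' - z) \<bullet> (u' - u)"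
    by (simp add: inner_diff_left inner_diff_right)
  also have "\<dots> \<le> dual_norm N (z' - z) * N (u' - u)"
    by (rule inner_le_dual_norm)
  finally show ?thesis
    using pos by (simp add: power2_eq_square)
qed (simp add: dual_norm_nonneg)

text \<open>The first-order remainder lies between 0, since \<open>u\<close> competes for
  \<open>z'\<close>, and \<open>(z' - z) \<bullet> (u' - u)\<close>, since \<open>u'\<close>
  competes for \<open>z\<close>. The Lipschitz bound makes it quadratic in the distance from
  \<open>z\<close> to \<open>z'\<close>.\<close>

lemma conj_gderiv:
  assumes u: "is_mirror_point z u"
  shows "GDERIV conjugate z :> u"
proof -
  define K where "K = equiv_const * (equiv_const / \<mu>)"
  have bound: "\<bar>conjugate z' - conjugate z - (z' - z) \<bullet> u\<bar> \<le> K * norm (z' - z) * norm (z' - z)" for z'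
  proof -
    obtain u' where u': "is_mirror_point z' u'"
      using ex_mirror_point by blast
    have X: "u \<in> X" "u' \<in> X"
      using u u' by (auto simp: is_mirror_point_def)
    have ineq: "z \<bullet> u' - \<psi> u' \<le> z \<bullet> u - \<psi> u" "z' \<bullet> u - \<psi> u \<le> z' \<bullet> u' - \<psi> u'"
      using u u' X \<mu>_pos unfolding is_mirror_point_def
      by (smt (verit) mult_nonneg_nonneg zero_le_power2 divide_nonneg_nonneg)+
    have "norm (u' - u) \<le> equiv_const * N (u' - u)"
      by (rule norm_le_equiv_const)
    also have "N (u' - u) \<le> dual_norm N (z' - z) / \<mu>"
      using mirror_point_lipschitz[OF u u'] \<mu>_pos by (simp add: field_simps)
    also have "\<dots> \<le> equiv_const * norm (z' - z) / \<mu>"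
      using dual_norm_le[of "z' - z"] \<mu>_pos by (intro divide_right_mono) auto
    finally have "norm (u' - u) \<le> K * norm (z' - z)"
      using equiv_const_pos by (simp add: K_def)
    then have "(z' - z) \<bullet> (u' - u) \<le> norm (z' - z) * (K * norm (z' - z))"
      using norm_cauchy_schwarz[of "z' - z" "u' - u"]
      by (meson mult_left_mono norm_ge_zero order_trans)
    then show ?thesis
      using ineq unfolding conj_eq[OF u] conj_eq[OF u']
      by (simp add: inner_diff_left inner_diff_right algebra_simps)
  qed
  have "((\<lambda>z'. K * norm (z' - z)) \<longlongrightarrow> K * norm (z - z)) (at z)"
    by (intro tendsto_intros)
  then have "((\<lambda>z'. K * norm (z' - z)) \<longlongrightarrow> 0) (at z)"
    by simp
  then have "((\<lambda>z'. (conjugate z' - conjugate z - (z' - z) \<bullet> u) /\<^sub>R norm (z' - z)) \<longlongrightarrow> 0) (at z)"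
    by (rule Lim_null_comparison[rotated])
      (use bound in \<open>auto simp: eventually_at_filter divide_simps abs_mult intro!: always_eventually\<close>)
  then show ?thesis
    unfolding gderiv_def has_derivative_at_within
    by (simp add: bounded_linear_inner_left)
qed

text \<open>Uniqueness of derivatives resolves the definite description in \<open>gradient\<close>
  and identifies the gradient of the conjugate with the maximizer.\<close>

lemma mirror_eq: "mirror_map z = u" if "is_mirror_point z u"
proof -
  have "g = u" if "GDERIV conjugate z :> g" for g
    using has_derivative_unique[OF that[unfolded gderiv_def] conj_gderiv[OF \<open>is_mirror_point z u\<close>, unfolded gderiv_def]]
    by (metis inner_commute vector_eq_ldot)
  then show ?thesis
    unfolding gradient_def using conj_gderiv[OF that] by (intro the_equality)
qed

lemma mirror_map_point: "is_mirror_point z (mirror_map z)"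
  using ex_mirror_point[of z] mirror_eq by metis

lemma mirror_in: "mirror_map z \<in> X"
  using mirror_map_point by (simp add: is_mirror_point_def)

lemma mirror_max: "v \<in> X \<Longrightarrow> z \<bullet> v - \<psi> v + \<mu> / 2 * (N (v - mirror_map z))\<^sup>2 \<le> conjugate z"
  using mirror_map_point[of z] conj_eq[OF mirror_map_point] by (simp add: is_mirror_point_def)

lemma conj_mirror: "conjugate z = z \<bullet> mirror_map z - \<psi> (mirror_map z)"
  by (rule conj_eq[OF mirror_map_point])

lemma mirror_lipschitz: "\<mu> * N (mirror_map z' - mirror_map z) \<le> dual_norm N (z' - z)"
  by (rule mirror_point_lipschitz[OF mirror_map_point mirror_map_point])

text \<open>For \<open>z = g\<psi> u\<close> the variational inequality at \<open>u\<close> holds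
  with equality.\<close>

lemma mirror_gradient: "u \<in> X \<Longrightarrow> mirror_map (g\<psi> u) = u"
  by (intro mirror_eq is_mirror_pointI) auto

lemma borel_measurable_conj [measurable]: "conjugate \<in> borel_measurable borel"
  using conj_gderiv[OF mirror_map_point] unfolding gderiv_def
  by (intro borel_measurable_continuous_onI)
    (meson continuous_at_imp_continuous_on has_derivative_continuous)

lemma borel_measurable_mirror [measurable]: "mirror_map \<in> borel_measurable borel"
proof (intro borel_measurable_continuous_onI lipschitz_on_continuous_on lipschitz_onI)
  fix z z'
  have "norm (mirror_map z - mirror_map z') \<le> equiv_const * N (mirror_map z - mirror_map z')"
    by (rule norm_le_equiv_const)
  also have "N (mirror_map z - mirror_map z') \<le> dual_norm N (z - z') / \<mu>"
    using mirror_lipschitz[of z z'] \<mu>_pos by (simp add: field_simps)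
  also have "\<dots> \<le> equiv_const * norm (z - z') / \<mu>"
    using dual_norm_le[of "z - z'"] \<mu>_pos by (intro divide_right_mono) auto
  finally show "dist (mirror_map z) (mirror_map z') \<le> equiv_const * (equiv_const / \<mu>) * dist z z'"
    using equiv_const_pos by (simp add: dist_norm)
qed (use equiv_const_pos \<mu>_pos in simp)

end

section \<open>The AGD+ iteration\<close>

lemma A_sum_0 [simp]: "A_sum a 0 = 0"
  and A_sum_Suc: "A_sum a (Suc k) = A_sum a k + a (Suc k)"
  by (simp_all add: A_sum_def)

locale agd_setup = mirror_setup N X \<psi> g\<psi> \<mu>
  for N :: "'a::euclidean_space \<Rightarrow> real" and X \<psi> g\<psi> \<mu> +
  fixes f :: "'a \<Rightarrow> real" and gf :: "'a \<Rightarrow> 'a" and L :: real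
    and x0 xstar :: 'a and a :: "nat \<Rightarrow> real"
  assumes convex_f: "convex_on X f"
    and gradient_f: "has_gradient_on X f gf" and continuous_gf: "continuous_on X gf"
    and L_pos: "L > 0" and smooth_f: "L_smooth_on X N L f gf"
    and minimizer: "is_arg_min f (\<lambda>u. u \<in> X) xstar"
    and x0_in: "x0 \<in> X"
    and a_pos: "\<And>k. k \<ge> 1 \<Longrightarrow> a k > 0"
    and a_le: "\<And>k. k \<ge> 1 \<Longrightarrow> (a k)\<^sup>2 / A_sum a k \<le> \<mu> / L"
begin

abbreviation "A \<equiv> A_sum a"

lemma xstar_in: "xstar \<in> X"
  and f_xstar_le: "u \<in> X \<Longrightarrow> f xstar \<le> f u"
  using minimizer by (auto simp: is_arg_min_linorder)

lemma a_Suc_pos: "a (Suc k) > 0"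
  by (rule a_pos) simp

lemma A_nonneg: "A k \<ge> 0"
  by (induction k) (use a_Suc_pos in \<open>auto simp: A_sum_Suc intro: less_imp_le add_nonneg_nonneg\<close>)

lemma A_Suc_pos: "A (Suc k) > 0"
  using A_nonneg[of k] a_Suc_pos[of k] by (simp add: A_sum_Suc)

text \<open>One map serves for both primal updates: with the old dual point it gives the query
  point, with the new one the next \<open>y\<close>.\<close>

definition avg :: "nat \<Rightarrow> 'a \<Rightarrow> 'a \<Rightarrow> 'a" where
  "avg k y z = (A k / A (Suc k)) *\<^sub>R y + (a (Suc k) / A (Suc k)) *\<^sub>R mirror_map z"

text \<open>The error is an argument so that the same step can also be taken with error 0.\<close>

definition dual_step :: "nat \<Rightarrow> 'a \<Rightarrow> 'a \<Rightarrow> 'a \<Rightarrow> 'a" where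
  "dual_step k y z e = z - a (Suc k) *\<^sub>R (gf (avg k y z) + e)"

definition potential :: "nat \<Rightarrow> 'a \<Rightarrow> 'a \<Rightarrow> real" where
  "potential k y z = A k * (f y - f xstar) + (conjugate z - z \<bullet> xstar + \<psi> xstar)"

lemma avg_in: "avg k y z \<in> X" if "y \<in> X"
proof -
  have "A k / A (Suc k) + a (Suc k) / A (Suc k) = 1"
    using A_Suc_pos[of k] by (simp add: A_sum_Suc add_divide_distrib[symmetric])
  then show ?thesis
    unfolding avg_def using convex_X that mirror_in A_nonneg[of k] A_Suc_pos[of k] a_Suc_pos[of k]
    by (intro convexD) auto
qed

lemma scaled_avg: "A (Suc k) *\<^sub>R avg k y z = A k *\<^sub>R y + a (Suc k) *\<^sub>R mirror_map z"
  using A_Suc_pos[of k] by (simp add: avg_def scaleR_add_right)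

section \<open>Lower bounds on the potential and its change in one step\<close>

lemma fenchel_gap: "\<mu> / 2 * (N (mirror_map z - xstar))\<^sup>2 \<le> conjugate z - z \<bullet> xstar + \<psi> xstar"
  using mirror_max[OF xstar_in, of z] by (simp add: N_minus_commute)

lemma gap_le_potential: "A k * (f y - f xstar) \<le> potential k y z"
  using order_trans[OF _ fenchel_gap[of z], of 0] \<mu>_pos by (simp add: potential_def)

lemma distance_le_potential:
  "y \<in> X \<Longrightarrow> \<mu> / 2 * (N (mirror_map z - xstar))\<^sup>2 \<le> potential k y z"
  unfolding potential_def using f_xstar_le[of y] A_nonneg[of k]
  by (intro add_increasing[OF _ fenchel_gap] mult_nonneg_nonneg) auto

lemma potential_nonneg: "y \<in> X \<Longrightarrow> 0 \<le> potential k y z"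
  using order_trans[OF _ distance_le_potential[of y z k], of 0] \<mu>_pos by simp

text \<open>Three estimates are added: smoothness from \<open>x\<close> to \<open>y'\<close>,
  convexity at \<open>x\<close> towards \<open>y\<close> and \<open>xstar\<close>, and the quadratic
  margin of \<open>v\<close> tested at \<open>v'\<close>. The gradient terms cancel, the margin
  absorbs the smoothness error, and only the error pairing remains.\<close>

lemma potential_step:
  assumes y: "y \<in> X" and z': "z' = dual_step k y z e"
  shows "potential (Suc k) (avg k y z') z'
           \<le> potential k y z - a (Suc k) * (e \<bullet> (mirror_map z' - xstar))"
proof -
  define x v v' \<alpha> where "x = avg k y z" and "v = mirror_map z" and "v' = mirror_map z'"
    and "\<alpha> = a (Suc k)"
  define y' g where "y' = avg k y z'" and "g = gf x"
  have inX: "x \<in> X" "y' \<in> X" "v \<in> X" "v' \<in> X"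
    using y by (simp_all add: x_def y'_def v_def v'_def avg_in mirror_in)
  note pos = A_Suc_pos[of k] A_nonneg[of k] a_Suc_pos[of k, folded \<alpha>_def]
  have A_Suc: "A (Suc k) = A k + \<alpha>"
    by (simp add: A_sum_Suc \<alpha>_def)
  have Ax: "A (Suc k) *\<^sub>R x = A k *\<^sub>R y + \<alpha> *\<^sub>R v"
    by (simp add: x_def v_def \<alpha>_def scaled_avg)
  \<comment> \<open>Both points are averages with the same weights and the same \<open>y\<close>, so
    only the mirror points differ.\<close>
  have diff: "y' - x = (\<alpha> / A (Suc k)) *\<^sub>R (v' - v)"
    by (simp add: x_def y'_def v_def v'_def \<alpha>_def avg_def scaleR_diff_right)
  have smooth: "A (Suc k) * f y' \<le> A (Suc k) * f x + \<alpha> * (g \<bullet> (v' - v)) + \<mu> / 2 * (N (v' - v))\<^sup>2"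
  proof -
    \<comment> \<open>The step-size condition is what lets strong convexity pay for
      smoothness.\<close>
    have "\<alpha>\<^sup>2 / A (Suc k) \<le> \<mu> / L"
      using a_le[of "Suc k"] by (simp add: \<alpha>_def)
    then have "L * (\<alpha>\<^sup>2 / A (Suc k)) \<le> \<mu>"
      using L_pos by (simp add: pos_le_divide_eq mult.commute)
    then have le: "L * (\<alpha>\<^sup>2 / A (Suc k)) * (N (v' - v))\<^sup>2 \<le> \<mu> * (N (v' - v))\<^sup>2"
      by (rule mult_right_mono) simp
    have inner_eq: "A (Suc k) * (g \<bullet> (y' - x)) = \<alpha> * (g \<bullet> (v' - v))"
      using pos by (simp add: diff)
    have "A (Suc k) * (N (y' - x))\<^sup>2 = \<alpha>\<^sup>2 / A (Suc k) * (N (v' - v))\<^sup>2"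
      using pos unfolding diff N_scale by (simp add: power2_eq_square)
    then have norm_eq: "A (Suc k) * (L / 2 * (N (y' - x))\<^sup>2)
        = L * (\<alpha>\<^sup>2 / A (Suc k)) * (N (v' - v))\<^sup>2 / 2"
      by (metis mult.assoc mult.commute times_divide_eq_left times_divide_eq_right)
    have "f y' \<le> f x + g \<bullet> (y' - x) + L / 2 * (N (y' - x))\<^sup>2"
      using smooth_f inX by (simp add: L_smooth_on_def g_def)
    then have "A (Suc k) * f y' \<le> A (Suc k) * (f x + g \<bullet> (y' - x) + L / 2 * (N (y' - x))\<^sup>2)"
      using pos by simp
    also have "\<dots> = A (Suc k) * f x + \<alpha> * (g \<bullet> (v' - v))
        + L * (\<alpha>\<^sup>2 / A (Suc k)) * (N (v' - v))\<^sup>2 / 2"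
      by (simp only: distrib_left inner_eq norm_eq)
    also have "\<dots> \<le> A (Suc k) * f x + \<alpha> * (g \<bullet> (v' - v)) + \<mu> / 2 * (N (v' - v))\<^sup>2"
      using le by simp
    finally show ?thesis .
  qed
  have "f x + g \<bullet> (y - x) \<le> f y" "f x + g \<bullet> (xstar - x) \<le> f xstar"
    using convex_on_gradient_le[OF gradient_f convex_f] inX y xstar_in by (auto simp: g_def)
  \<comment> \<open>With these weights the definition of \<open>x\<close> eliminates
    \<open>y\<close> and leaves a gradient term in \<open>xstar - v\<close>.\<close>
  then have "A k * (f x + g \<bullet> (y - x)) + \<alpha> * (f x + g \<bullet> (xstar - x)) \<le> A k * f y + \<alpha> * f xstar"
    using pos by (intro add_mono mult_left_mono) auto
  moreover have "A k * (f x + g \<bullet> (y - x)) + \<alpha> * (f x + g \<bullet> (xstar - x))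
      = A (Suc k) * f x + \<alpha> * (g \<bullet> (xstar - v))"
  proof -
    have "A k * (g \<bullet> y) + \<alpha> * (g \<bullet> v) = A (Suc k) * (g \<bullet> x)"
      using arg_cong[OF Ax, of "inner g"] by (simp add: inner_add_right)
    then show ?thesis
      by (simp add: A_Suc inner_diff_right algebra_simps)
  qed
  ultimately have convex: "A (Suc k) * f x + \<alpha> * (g \<bullet> (xstar - v)) \<le> A k * f y + \<alpha> * f xstar"
    by simp
  have "z \<bullet> v' - \<psi> v' + \<mu> / 2 * (N (v' - v))\<^sup>2 \<le> conjugate z"
    unfolding v_def by (rule mirror_max) fact
  moreover have "conjugate z' = z' \<bullet> v' - \<psi> v'"
    by (simp add: v'_def conj_mirror)
  moreover have "z' \<bullet> v' = z \<bullet> v' - \<alpha> * (g \<bullet> v') - \<alpha> * (e \<bullet> v')"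
    "z' \<bullet> xstar = z \<bullet> xstar - \<alpha> * (g \<bullet> xstar) - \<alpha> * (e \<bullet> xstar)"
    by (simp_all add: z' dual_step_def \<alpha>_def g_def x_def inner_diff_left inner_add_left distrib_left)
  ultimately show ?thesis
    using smooth convex
    unfolding potential_def v'_def[symmetric] y'_def[symmetric] \<alpha>_def[symmetric] A_Suc
    by (simp add: inner_diff_right algebra_simps)
qed

text \<open>The two dual points differ by a multiple of \<open>e\<close>, so their mirror points are
  close by the Lipschitz bound. Pairing their difference with \<open>e\<close> produces the squared
  dual norm.\<close>

lemma potential_step_decoupled:
  fixes e :: 'a
  assumes y: "y \<in> X" and z': "z' = dual_step k y z e"
    and v: "v = mirror_map (dual_step k y z 0)"
  shows "potential (Suc k) (avg k y z') z' \<le> potential k y z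
           + (a (Suc k))\<^sup>2 * (dual_norm N e)\<^sup>2 / \<mu> - a (Suc k) * (e \<bullet> (v - xstar))"
proof -
  let ?\<alpha> = "a (Suc k)"
  have "dual_step k y z 0 - z' = ?\<alpha> *\<^sub>R e"
    by (simp add: z' dual_step_def algebra_simps)
  then have "\<mu> * N (v - mirror_map z') \<le> dual_norm N (?\<alpha> *\<^sub>R e)"
    using mirror_lipschitz[of "dual_step k y z 0" z'] by (simp add: v)
  also have "\<dots> \<le> ?\<alpha> * dual_norm N e"
    using a_Suc_pos[of k] by (intro dual_norm_scale_le) simp
  finally have "N (v - mirror_map z') \<le> ?\<alpha> * dual_norm N e / \<mu>"
    using \<mu>_pos by (simp add: field_simps)
  then have "dual_norm N e * N (v - mirror_map z') \<le> dual_norm N e * (?\<alpha> * dual_norm N e / \<mu>)"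
    by (intro mult_left_mono dual_norm_nonneg)
  with inner_le_dual_norm[of e "v - mirror_map z'"]
  have "e \<bullet> (v - mirror_map z') \<le> ?\<alpha> * (dual_norm N e)\<^sup>2 / \<mu>"
    by (simp add: power2_eq_square algebra_simps)
  then have "?\<alpha> * (e \<bullet> (v - mirror_map z')) \<le> ?\<alpha> * (?\<alpha> * (dual_norm N e)\<^sup>2 / \<mu>)"
    using a_Suc_pos[of k] by (intro mult_left_mono) auto
  then show ?thesis
    using potential_step[OF y z'] by (simp add: inner_diff_right power2_eq_square algebra_simps)
qed

text \<open>With error 0 the step does not raise the potential, and the new potential dominates the
  squared distance.\<close>

lemma noise_free_distance_le_potential:
  assumes "y \<in> X"
  shows "\<mu> / 2 * (N (mirror_map (dual_step k y z 0) - xstar))\<^sup>2 \<le> potential k y z"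
  using potential_step[OF assms refl, of k z 0] avg_in[OF assms]
    distance_le_potential[of "avg k y (dual_step k y z 0)" "dual_step k y z 0" "Suc k"]
  by simp

text \<open>The initial \<open>y\<close> is a dummy: it enters the first step with weight \<open>A 0 = 0\<close>.\<close>
primrec agd_state :: "(nat \<Rightarrow> 'a) \<Rightarrow> nat \<Rightarrow> 'a \<times> 'a" where
  "agd_state w 0 = (x0, g\<psi> x0)"
| "agd_state w (Suc k) =
     (let y = fst (agd_state w k); z' = dual_step k y (snd (agd_state w k)) (w (Suc k))
      in (avg k y z', z'))"

lemma agd_state_in: "fst (agd_state w k) \<in> X"
  by (induction k) (auto simp: x0_in Let_def avg_in)

text \<open>The state after \<open>k\<close> steps reads only the errors 1 to \<open>k\<close>,
  which is the source of its independence from the next error.\<close>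

lemma agd_state_cong: "(\<And>i. i \<in> {1..k} \<Longrightarrow> w i = w' i) \<Longrightarrow> agd_state w k = agd_state w' k"
  by (induction k) auto

lemma avg_0: "avg 0 y z = mirror_map z"
  using a_Suc_pos[of 0] by (simp add: avg_def A_sum_Suc)

lemma agd_plus_eq_state:
  assumes run: "agd_plus X gf \<psi> g\<psi> a x0 w x y z" and "k \<ge> 1"
  shows "(y k, z k) = agd_state w k"
  using \<open>k \<ge> 1\<close>
proof (induction k rule: nat_induct_at_least)
  case base
  \<comment> \<open>The special first step fits the recursion: weight \<open>A 0 = 0\<close> gives
    \<open>y 1\<close> as a mirror point, and \<open>x 1 = x0\<close> is the mirror point of
    \<open>g\<psi> x0\<close>.\<close>
  show ?case
    using run by (simp add: agd_plus_def Let_def dual_step_def avg_0 mirror_gradient x0_in)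
next
  case (Suc k)
  have step: "x (Suc k) = avg k (y k) (z k)"
    "z (Suc k) = z k - a (Suc k) *\<^sub>R (gf (x (Suc k)) + w (Suc k))"
    "y (Suc k) = avg k (y k) (z (Suc k))"
    using run Suc.hyps unfolding agd_plus_def Let_def avg_def
    by (auto dest!: spec[of _ "Suc k"])
  show ?case
    using Suc.IH[symmetric] step by (simp add: Let_def dual_step_def)
qed

lemma potential_0: "potential 0 x0 (g\<psi> x0) = bregman \<psi> g\<psi> xstar x0"
  using conj_mirror[of "g\<psi> x0"] mirror_gradient[OF x0_in]
  by (simp add: potential_def bregman_def inner_diff_right)

section \<open>Measurability of the iteration in the errors\<close>

lemma borel_measurable_on_X:
  assumes "continuous_on X g" "h \<in> borel_measurable M" "\<And>\<omega>. h \<omega> \<in> X"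
  shows "(\<lambda>\<omega>. g (h \<omega>)) \<in> borel_measurable M"
proof -
  \<comment> \<open>Continuity is known only on \<open>X\<close>, so measurability is obtained on
    the subspace and composed with a map into \<open>X\<close>.\<close>
  have "g \<in> borel_measurable (restrict_space borel X)"
    using assms(1) by (rule borel_measurable_continuous_on_restrict)
  moreover have "h \<in> measurable M (restrict_space borel X)"
    using assms(2,3) by (intro measurable_restrict_space2) auto
  ultimately show ?thesis
    by (rule measurable_compose[rotated])
qed

lemma borel_measurable_avg [measurable (raw)]:
  assumes [measurable]: "g \<in> borel_measurable M" "h \<in> borel_measurable M"
  shows "(\<lambda>\<omega>. avg k (g \<omega>) (h \<omega>)) \<in> borel_measurable M"
  unfolding avg_def by measurable

lemma borel_measurable_dual_step:
  assumes [measurable]: "g \<in> borel_measurable M" "h \<in> borel_measurable M" "e \<in> borel_measurable M"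
    and "\<And>\<omega>. g \<omega> \<in> X"
  shows "(\<lambda>\<omega>. dual_step k (g \<omega>) (h \<omega>) (e \<omega>)) \<in> borel_measurable M"
proof -
  have [measurable]: "(\<lambda>\<omega>. gf (avg k (g \<omega>) (h \<omega>))) \<in> borel_measurable M"
    using assms(4) by (intro borel_measurable_on_X[OF continuous_gf] avg_in) measurable
  show ?thesis
    unfolding dual_step_def by measurable
qed

text \<open>The measure is arbitrary because this is applied both on the probability space and on
  the product space of error sequences.\<close>

lemma borel_measurable_agd_state:
  assumes "\<And>i. i \<in> {1..k} \<Longrightarrow> (\<lambda>\<omega>. w \<omega> i) \<in> borel_measurable M"
  shows "(\<lambda>\<omega>. fst (agd_state (w \<omega>) k)) \<in> borel_measurable M
    \<and> (\<lambda>\<omega>. snd (agd_state (w \<omega>) k)) \<in> borel_measurable M"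
  using assms
proof (induction k)
  case (Suc k)
  then have [measurable]: "(\<lambda>\<omega>. fst (agd_state (w \<omega>) k)) \<in> borel_measurable M"
    "(\<lambda>\<omega>. snd (agd_state (w \<omega>) k)) \<in> borel_measurable M"
    by auto
  have [measurable]: "(\<lambda>\<omega>. dual_step k (fst (agd_state (w \<omega>) k)) (snd (agd_state (w \<omega>) k)) (w \<omega> (Suc k)))
      \<in> borel_measurable M"
    using Suc.prems by (intro borel_measurable_dual_step agd_state_in) auto
  show ?case
    by (simp add: Let_def)
qed auto

lemma borel_measurable_potential:
  assumes [measurable]: "g \<in> borel_measurable M" "h \<in> borel_measurable M"
    and "\<And>\<omega>. g \<omega> \<in> X"
  shows "(\<lambda>\<omega>. potential k (g \<omega>) (h \<omega>)) \<in> borel_measurable M"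
proof -
  have [measurable]: "(\<lambda>\<omega>. f (g \<omega>)) \<in> borel_measurable M"
    using assms(3)
    by (intro borel_measurable_on_X[OF has_gradient_on_imp_continuous_on[OF gradient_f]]) auto
  show ?thesis
    unfolding potential_def by measurable
qed

end

section \<open>Expected progress\<close>

text \<open>Coordinates of independent vectors are independent, so the scalar product rule applies
  to each summand of the inner product.\<close>

lemma (in prob_space) indep_var_inner:
  fixes U W :: "'a \<Rightarrow> 'b::euclidean_space"
  assumes indep: "indep_var borel U borel W" and int: "integrable M U" "integrable M W"
  shows indep_var_integrable_inner: "integrable M (\<lambda>\<omega>. U \<omega> \<bullet> W \<omega>)"
    and indep_var_integral_inner:
      "(\<integral>\<omega>. U \<omega> \<bullet> W \<omega> \<partial>M) = (\<integral>\<omega>. U \<omega> \<partial>M) \<bullet> (\<integral>\<omega>. W \<omega> \<partial>M)"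
proof -
  have coords: "indep_var borel (\<lambda>\<omega>. U \<omega> \<bullet> b) borel (\<lambda>\<omega>. W \<omega> \<bullet> b)" for b
    using indep_var_compose[OF indep, of "\<lambda>u. u \<bullet> b" borel "\<lambda>u. u \<bullet> b" borel]
    by (simp add: comp_def)
  have int': "integrable M (\<lambda>\<omega>. U \<omega> \<bullet> b)" "integrable M (\<lambda>\<omega>. W \<omega> \<bullet> b)" for b
    using int by auto
  note prods = indep_var_integrable[OF coords int'] indep_var_lebesgue_integral[OF coords int']
  have sum_eq: "U \<omega> \<bullet> W \<omega> = (\<Sum>b\<in>Basis. (U \<omega> \<bullet> b) * (W \<omega> \<bullet> b))" for \<omega>
    by (rule euclidean_inner)
  show "integrable M (\<lambda>\<omega>. U \<omega> \<bullet> W \<omega>)"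
    unfolding sum_eq by (intro Bochner_Integration.integrable_sum prods)
  have "(\<integral>\<omega>. U \<omega> \<bullet> W \<omega> \<partial>M) = (\<Sum>b\<in>Basis. (\<integral>\<omega>. U \<omega> \<bullet> b \<partial>M) * (\<integral>\<omega>. W \<omega> \<bullet> b \<partial>M))"
    unfolding sum_eq by (simp only: Bochner_Integration.integral_sum prods)
  also have "\<dots> = (\<Sum>b\<in>Basis. ((\<integral>\<omega>. U \<omega> \<partial>M) \<bullet> b) * ((\<integral>\<omega>. W \<omega> \<partial>M) \<bullet> b))"
    using int by simp
  also have "\<dots> = (\<integral>\<omega>. U \<omega> \<partial>M) \<bullet> (\<integral>\<omega>. W \<omega> \<partial>M)"
    by (rule euclidean_inner[symmetric])
  finally show "(\<integral>\<omega>. U \<omega> \<bullet> W \<omega> \<partial>M) = (\<integral>\<omega>. U \<omega> \<partial>M) \<bullet> (\<integral>\<omega>. W \<omega> \<partial>M)" .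
qed

section \<open>The random run and its noise-free comparison points\<close>

locale stochastic_agd = agd_setup N X \<psi> g\<psi> \<mu> f gf L x0 xstar a + prob_space M
  for N :: "'a::euclidean_space \<Rightarrow> real" and X \<psi> g\<psi> \<mu> f gf L x0 xstar a
    and M :: "'w measure" +
  fixes \<eta> :: "nat \<Rightarrow> 'w \<Rightarrow> 'a"
  assumes indep_\<eta>: "indep_vars (\<lambda>_. borel) \<eta> {1..}"
    and integrable_\<eta>: "\<And>k. k \<ge> 1 \<Longrightarrow> integrable M (\<eta> k)"
    and mean_\<eta>: "\<And>k. k \<ge> 1 \<Longrightarrow> integral\<^sup>L M (\<eta> k) = 0"
begin

definition "Y k \<omega> = fst (agd_state (\<lambda>i. \<eta> i \<omega>) k)"
definition "Z k \<omega> = snd (agd_state (\<lambda>i. \<eta> i \<omega>) k)"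
definition "noise_free k \<omega> = mirror_map (dual_step k (Y k \<omega>) (Z k \<omega>) 0)"

abbreviation "P k \<omega> \<equiv> potential k (Y k \<omega>) (Z k \<omega>)"

lemma Y_in: "Y k \<omega> \<in> X"
  by (simp add: Y_def agd_state_in)

lemma borel_measurable_\<eta>: "k \<ge> 1 \<Longrightarrow> \<eta> k \<in> borel_measurable M"
  by (intro borel_measurable_integrable integrable_\<eta>)

lemma borel_measurable_YZ [measurable]:
  "Y k \<in> borel_measurable M" "Z k \<in> borel_measurable M"
proof -
  have "\<eta> i \<in> borel_measurable M" if "i \<in> {1..k}" for i
    using that by (intro borel_measurable_\<eta>) simp
  from borel_measurable_agd_state[of k "\<lambda>\<omega> i. \<eta> i \<omega>", OF this]
  show "Y k \<in> borel_measurable M" "Z k \<in> borel_measurable M"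
    unfolding Y_def Z_def by blast+
qed

lemma borel_measurable_P [measurable]: "P k \<in> borel_measurable M"
  by (intro borel_measurable_potential Y_in) auto

lemma borel_measurable_noise_free [measurable]: "noise_free k \<in> borel_measurable M"
proof -
  have [measurable]: "(\<lambda>\<omega>. dual_step k (Y k \<omega>) (Z k \<omega>) 0) \<in> borel_measurable M"
    by (intro borel_measurable_dual_step Y_in) auto
  show ?thesis
    unfolding noise_free_def by measurable
qed

text \<open>The comparison point is a measurable function \<open>h\<close> of the errors 1 to
  \<open>k\<close>, an index block disjoint from \<open>Suc k\<close>.\<close>

lemma indep_noise_free: "indep_var borel (\<eta> (Suc k)) borel (\<lambda>\<omega>. noise_free k \<omega> - xstar)"
proof -
  define h where "h w = mirror_map (dual_step k (fst (agd_state w k)) (snd (agd_state w k)) 0) - xstar"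
    for w
  let ?P = "Pi\<^sub>M {1..k} (\<lambda>_. borel) :: (nat \<Rightarrow> 'a) measure"
  have "(\<lambda>w. w i) \<in> borel_measurable ?P" if "i \<in> {1..k}" for i
    using that by (rule measurable_component_singleton)
  from borel_measurable_agd_state[of k "\<lambda>w. w", OF this]
  have state: "(\<lambda>w. fst (agd_state w k)) \<in> borel_measurable ?P"
    "(\<lambda>w. snd (agd_state w k)) \<in> borel_measurable ?P"
    by blast+
  have [measurable]: "(\<lambda>w. dual_step k (fst (agd_state w k)) (snd (agd_state w k)) 0)
      \<in> borel_measurable ?P"
    by (rule borel_measurable_dual_step[OF state borel_measurable_const agd_state_in])
  have h: "h \<in> borel_measurable ?P"
    unfolding h_def by measurable
  have "indep_var (Pi\<^sub>M {Suc k} (\<lambda>_. borel)) (\<lambda>\<omega>. restrict (\<lambda>i. \<eta> i \<omega>) {Suc k})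
      ?P (\<lambda>\<omega>. restrict (\<lambda>i. \<eta> i \<omega>) {1..k})"
    by (rule indep_var_restrict[OF indep_\<eta>]) auto
  from indep_var_compose[OF this _ h, of "\<lambda>w. w (Suc k)" borel]
  have "indep_var borel (\<lambda>\<omega>. \<eta> (Suc k) \<omega>) borel (\<lambda>\<omega>. h (restrict (\<lambda>i. \<eta> i \<omega>) {1..k}))"
    by (simp add: comp_def)
  \<comment> \<open>Restriction changes the sequence only at indices that the first \<open>k\<close>
    steps never read.\<close>
  moreover have "h (restrict (\<lambda>i. \<eta> i \<omega>) {1..k}) = noise_free k \<omega> - xstar" for \<omega>
    using agd_state_cong[of k "restrict (\<lambda>i. \<eta> i \<omega>) {1..k}" "\<lambda>i. \<eta> i \<omega>"]
    by (simp add: h_def noise_free_def Y_def Z_def)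
  ultimately show ?thesis
    by simp
qed

lemma integrable_noise_free:
  assumes "integrable M (P k)"
  shows "integrable M (\<lambda>\<omega>. noise_free k \<omega> - xstar)"
proof (rule Bochner_Integration.integrable_bound)
  show "integrable M (\<lambda>\<omega>. equiv_const * (1 + 2 / \<mu> * P k \<omega>))"
    using assms by simp
  show "AE \<omega> in M. norm (noise_free k \<omega> - xstar) \<le> norm (equiv_const * (1 + 2 / \<mu> * P k \<omega>))"
  proof (rule AE_I2)
    fix \<omega>
    let ?n = "N (noise_free k \<omega> - xstar)"
    have "?n\<^sup>2 \<le> 2 / \<mu> * P k \<omega>"
      using noise_free_distance_le_potential[OF Y_in[of k \<omega>], of k "Z k \<omega>"] \<mu>_pos
      by (simp add: noise_free_def field_simps)
    \<comment> \<open>Expanded, this bounds the distance by one plus its square, so control of the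
      square gives an integrable majorant.\<close>
    moreover have "0 \<le> (?n - 1)\<^sup>2 + ?n"
      by simp
    then have "?n \<le> 1 + ?n\<^sup>2"
      by (simp add: power2_eq_square algebra_simps)
    ultimately have "?n \<le> 1 + 2 / \<mu> * P k \<omega>"
      by linarith
    then have "equiv_const * ?n \<le> equiv_const * (1 + 2 / \<mu> * P k \<omega>)"
      using equiv_const_pos by (intro mult_left_mono) auto
    then show "norm (noise_free k \<omega> - xstar) \<le> norm (equiv_const * (1 + 2 / \<mu> * P k \<omega>))"
      using norm_le_equiv_const[of "noise_free k \<omega> - xstar"] by simp
  qed
qed simp

text \<open>Integrability belongs to the induction: it makes the comparison point integrable, and
  hence the error pairing integrable with mean zero.\<close>

lemma expected_potential:
  assumes "\<And>i. i \<in> {1..k} \<Longrightarrow> integrable M (\<lambda>\<omega>. (dual_norm N (\<eta> i \<omega>))\<^sup>2)"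
  shows "integrable M (P k) \<and> expectation (P k) \<le> bregman \<psi> g\<psi> xstar x0
           + (\<Sum>i=1..k. (a i)\<^sup>2 * expectation (\<lambda>\<omega>. (dual_norm N (\<eta> i \<omega>))\<^sup>2)) / \<mu>"
  using assms
proof (induction k)
  case 0
  then show ?case
    by (simp add: Y_def Z_def potential_0 prob_space)
next
  case (Suc k)
  let ?\<alpha> = "a (Suc k)" and ?e = "\<eta> (Suc k)"
  define R where "R \<omega> = P k \<omega> + ?\<alpha>\<^sup>2 * (dual_norm N (?e \<omega>))\<^sup>2 / \<mu>
      - ?\<alpha> * (?e \<omega> \<bullet> (noise_free k \<omega> - xstar))" for \<omega>
  have int_P: "integrable M (P k)"
    and int_e: "integrable M (\<lambda>\<omega>. (dual_norm N (?e \<omega>))\<^sup>2)"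
    using Suc by auto
  note inner = indep_var_integrable_inner[OF indep_noise_free integrable_\<eta> integrable_noise_free[OF int_P]]
    indep_var_integral_inner[OF indep_noise_free integrable_\<eta> integrable_noise_free[OF int_P]]
  have int_R: "integrable M R"
    unfolding R_def using int_P int_e inner(1) by simp
  have P_le: "P (Suc k) \<omega> \<le> R \<omega>" for \<omega>
    unfolding R_def noise_free_def
    using potential_step_decoupled[OF Y_in[of k \<omega>] refl refl, of k "Z k \<omega>" "?e \<omega>"]
    by (simp add: Y_def Z_def Let_def)
  have int: "integrable M (P (Suc k))"
    using int_R
  proof (rule Bochner_Integration.integrable_bound)
    \<comment> \<open>The potential is nonnegative, so an upper bound also bounds its absolute
      value.\<close>
    show "AE \<omega> in M. norm (P (Suc k) \<omega>) \<le> norm (R \<omega>)"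
      using P_le potential_nonneg[OF Y_in] by (auto intro!: AE_I2 order_trans[OF P_le])
  qed simp
  have "expectation (P (Suc k)) \<le> expectation R"
    using int int_R P_le by (intro integral_mono) auto
  \<comment> \<open>The expected pairing factors by independence and vanishes because the error has
    mean zero.\<close>
  also have "\<dots> = expectation (P k) + ?\<alpha>\<^sup>2 * expectation (\<lambda>\<omega>. (dual_norm N (?e \<omega>))\<^sup>2) / \<mu>"
    unfolding R_def using int_P int_e inner by (simp add: mean_\<eta>)
  also have "\<dots> \<le> bregman \<psi> g\<psi> xstar x0
      + (\<Sum>i=1..Suc k. (a i)\<^sup>2 * expectation (\<lambda>\<omega>. (dual_norm N (\<eta> i \<omega>))\<^sup>2)) / \<mu>"
    using Suc by (simp add: add_divide_distrib)
  finally show ?case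
    using int by simp
qed

lemma expected_gap:
  assumes k: "k \<ge> 1"
    and sq: "\<And>i. i \<in> {1..k} \<Longrightarrow> integrable M (\<lambda>\<omega>. (dual_norm N (\<eta> i \<omega>))\<^sup>2)"
  shows "integrable M (\<lambda>\<omega>. f (Y k \<omega>) - f xstar)"
    and "expectation (\<lambda>\<omega>. f (Y k \<omega>) - f xstar) \<le> bregman \<psi> g\<psi> xstar x0 / A k
           + (\<Sum>i=1..k. (a i)\<^sup>2 * expectation (\<lambda>\<omega>. (dual_norm N (\<eta> i \<omega>))\<^sup>2)) / (\<mu> * A k)"
proof -
  have A_pos: "A k > 0"
    using k A_Suc_pos[of "k - 1"] by simp
  have P: "integrable M (P k)" "expectation (P k) \<le> bregman \<psi> g\<psi> xstar x0
      + (\<Sum>i=1..k. (a i)\<^sup>2 * expectation (\<lambda>\<omega>. (dual_norm N (\<eta> i \<omega>))\<^sup>2)) / \<mu>"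
    using expected_potential[OF sq] by auto
  have gap_le: "f (Y k \<omega>) - f xstar \<le> P k \<omega> / A k" for \<omega>
    using gap_le_potential[of k "Y k \<omega>" "Z k \<omega>"] A_pos by (simp add: field_simps)
  have [measurable]: "(\<lambda>\<omega>. f (Y k \<omega>)) \<in> borel_measurable M"
    by (intro borel_measurable_on_X[OF has_gradient_on_imp_continuous_on[OF gradient_f]] Y_in) simp
  have int: "integrable M (\<lambda>\<omega>. P k \<omega> / A k)"
    using P(1) by simp
  show gap: "integrable M (\<lambda>\<omega>. f (Y k \<omega>) - f xstar)"
    using int
  proof (rule Bochner_Integration.integrable_bound)
    show "AE \<omega> in M. norm (f (Y k \<omega>) - f xstar) \<le> norm (P k \<omega> / A k)"
    proof (rule AE_I2)
      fix \<omega>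
      show "norm (f (Y k \<omega>) - f xstar) \<le> norm (P k \<omega> / A k)"
        using f_xstar_le[OF Y_in[of k \<omega>]] gap_le[of \<omega>] abs_ge_self[of "P k \<omega> / A k"]
        unfolding real_norm_def by linarith
    qed
  qed simp
  have "expectation (\<lambda>\<omega>. f (Y k \<omega>) - f xstar) \<le> expectation (\<lambda>\<omega>. P k \<omega> / A k)"
    using gap int gap_le by (rule integral_mono)
  also have "\<dots> = expectation (P k) / A k"
    by simp
  also have "\<dots> \<le> (bregman \<psi> g\<psi> xstar x0
      + (\<Sum>i=1..k. (a i)\<^sup>2 * expectation (\<lambda>\<omega>. (dual_norm N (\<eta> i \<omega>))\<^sup>2)) / \<mu>) / A k"
    using P(2) A_pos by (intro divide_right_mono) auto
  finally show "expectation (\<lambda>\<omega>. f (Y k \<omega>) - f xstar) \<le> bregman \<psi> g\<psi> xstar x0 / A k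
      + (\<Sum>i=1..k. (a i)\<^sup>2 * expectation (\<lambda>\<omega>. (dual_norm N (\<eta> i \<omega>))\<^sup>2)) / (\<mu> * A k)"
    by (simp add: add_divide_distrib)
qed

text \<open>If all second moments are finite, this is the real bound transported to
  \<open>ennreal\<close>. Otherwise one summand on the right is infinite, since its weight is
  nonzero.\<close>

lemma nn_expected_gap:
  assumes k: "k \<ge> 1"
  shows "(\<integral>\<^sup>+\<omega>. ennreal (f (Y k \<omega>) - f xstar) \<partial>M) \<le> ennreal (bregman \<psi> g\<psi> xstar x0 / A k)
           + (\<Sum>i=1..k. ennreal ((a i)\<^sup>2) * (\<integral>\<^sup>+\<omega>. ennreal ((dual_norm N (\<eta> i \<omega>))\<^sup>2) \<partial>M))
             / ennreal (\<mu> * A k)"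
proof (cases "\<forall>i\<in>{1..k}. integrable M (\<lambda>\<omega>. (dual_norm N (\<eta> i \<omega>))\<^sup>2)")
  case True
  have A_pos: "A k > 0"
    using k A_Suc_pos[of "k - 1"] by simp
  \<comment> \<open>Nonnegativity is needed to split \<open>ennreal\<close> of a sum; the Bregman
    divergence has it as the initial potential.\<close>
  have breg: "bregman \<psi> g\<psi> xstar x0 \<ge> 0"
    using potential_nonneg[OF x0_in, of 0 "g\<psi> x0"] by (simp add: potential_0)
  let ?S = "\<lambda>i. expectation (\<lambda>\<omega>. (dual_norm N (\<eta> i \<omega>))\<^sup>2)"
  have S_eq: "(\<integral>\<^sup>+\<omega>. ennreal ((dual_norm N (\<eta> i \<omega>))\<^sup>2) \<partial>M) = ennreal (?S i)" if "i \<in> {1..k}" for i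
    using True that by (intro nn_integral_eq_integral) auto
  have "(\<Sum>i=1..k. ennreal ((a i)\<^sup>2) * (\<integral>\<^sup>+\<omega>. ennreal ((dual_norm N (\<eta> i \<omega>))\<^sup>2) \<partial>M))
      = (\<Sum>i=1..k. ennreal ((a i)\<^sup>2 * ?S i))"
    by (intro sum.cong refl) (simp add: S_eq ennreal_mult)
  also have "\<dots> = ennreal (\<Sum>i=1..k. (a i)\<^sup>2 * ?S i)"
    by (intro sum_ennreal) simp
  finally have sum_eq: "(\<Sum>i=1..k. ennreal ((a i)\<^sup>2) * (\<integral>\<^sup>+\<omega>. ennreal ((dual_norm N (\<eta> i \<omega>))\<^sup>2) \<partial>M))
      = ennreal (\<Sum>i=1..k. (a i)\<^sup>2 * ?S i)" .
  have "(\<integral>\<^sup>+\<omega>. ennreal (f (Y k \<omega>) - f xstar) \<partial>M) = ennreal (expectation (\<lambda>\<omega>. f (Y k \<omega>) - f xstar))"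
    using True k f_xstar_le[OF Y_in] by (intro nn_integral_eq_integral expected_gap) auto
  also have "\<dots> \<le> ennreal (bregman \<psi> g\<psi> xstar x0 / A k + (\<Sum>i=1..k. (a i)\<^sup>2 * ?S i) / (\<mu> * A k))"
    using True k by (intro ennreal_leI expected_gap) auto
  also have "\<dots> = ennreal (bregman \<psi> g\<psi> xstar x0 / A k)
      + ennreal (\<Sum>i=1..k. (a i)\<^sup>2 * ?S i) / ennreal (\<mu> * A k)"
    using breg A_pos \<mu>_pos by (simp add: ennreal_plus divide_ennreal sum_nonneg)
  finally show ?thesis
    by (simp only: sum_eq)
next
  case False
  let ?T = "\<lambda>i. \<integral>\<^sup>+\<omega>. ennreal ((dual_norm N (\<eta> i \<omega>))\<^sup>2) \<partial>M"
  from False obtain i where i: "i \<in> {1..k}"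
    and not_int: "\<not> integrable M (\<lambda>\<omega>. (dual_norm N (\<eta> i \<omega>))\<^sup>2)"
    by blast
  have [measurable]: "\<eta> i \<in> borel_measurable M"
    using i by (intro borel_measurable_\<eta>) simp
  have "?T i = \<infinity>"
  proof (rule ccontr)
    assume "?T i \<noteq> \<infinity>"
    then have "integrable M (\<lambda>\<omega>. (dual_norm N (\<eta> i \<omega>))\<^sup>2)"
      by (intro integrableI_nonneg) (auto simp: less_top)
    with not_int show False ..
  qed
  moreover have "a i \<noteq> 0"
    using a_pos[of i] i by simp
  ultimately have "ennreal ((a i)\<^sup>2) * ?T i = \<infinity>"
    by (simp add: ennreal_mult_top)
  moreover have "ennreal ((a i)\<^sup>2) * ?T i \<le> (\<Sum>i=1..k. ennreal ((a i)\<^sup>2) * ?T i)"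
    using i by (intro member_le_sum) auto
  ultimately have "(\<Sum>i=1..k. ennreal ((a i)\<^sup>2) * ?T i) = \<infinity>"
    by (simp only: top_unique infinity_ennreal_def)
  then show ?thesis
    by (simp only: infinity_ennreal_def) (simp add: ennreal_top_divide)
qed

end

text \<open>The expectation appears in two forms. The \<open>ennreal\<close> form also covers
  infinite second moments; the Bochner form is conditional because a Bochner integral says nothing
  about a function that is not integrable.\<close>

theorem lemma3p7:
  fixes X :: "(real ^ 'n) set"
    and N :: "real ^ 'n \<Rightarrow> real"
    and f \<psi> :: "real ^ 'n \<Rightarrow> real"
    and gf g\<psi> :: "real ^ 'n \<Rightarrow> real ^ 'n"
    and L \<mu> :: real
    and x0 xstar :: "real ^ 'n"
    and a :: "nat \<Rightarrow> real"
    and M :: "'w measure"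
    and \<eta> x y z :: "nat \<Rightarrow> 'w \<Rightarrow> real ^ 'n"
  assumes "is_norm N"
    and "closed X" and "convex X"
    and "convex_on X f"
    and "has_gradient_on X f gf" and "continuous_on X gf"
    and "L > 0" and "L_smooth_on X N L f gf"
    and "is_arg_min f (\<lambda>u. u \<in> X) xstar"
    and "x0 \<in> X"
    and "has_gradient_on X \<psi> g\<psi>"
    and "\<mu> > 0" and "strongly_convex_on X N \<mu> \<psi> g\<psi>"
    and "\<And>k. k \<ge> 1 \<Longrightarrow> a k > 0"
    and "\<And>k. k \<ge> 1 \<Longrightarrow> (a k)\<^sup>2 / A_sum a k \<le> \<mu> / L"
    and "prob_space M"
    and "prob_space.indep_vars M (\<lambda>_. borel) \<eta> {1..}"
    and "\<And>k. k \<ge> 1 \<Longrightarrow> integrable M (\<eta> k) \<and> integral\<^sup>L M (\<eta> k) = 0"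
    and "\<And>\<omega>. \<omega> \<in> space M \<Longrightarrow>
           agd_plus X gf \<psi> g\<psi> a x0 (\<lambda>k. \<eta> k \<omega>) (\<lambda>k. x k \<omega>) (\<lambda>k. y k \<omega>) (\<lambda>k. z k \<omega>)"
  shows "\<forall>k\<ge>1.
      (\<integral>\<^sup>+\<omega>. ennreal (f (y k \<omega>) - f xstar) \<partial>M)
        \<le> ennreal (bregman \<psi> g\<psi> xstar x0 / A_sum a k)
          + (\<Sum>i=1..k. ennreal ((a i)\<^sup>2) * (\<integral>\<^sup>+\<omega>. ennreal ((dual_norm N (\<eta> i \<omega>))\<^sup>2) \<partial>M))
            / ennreal (\<mu> * A_sum a k)
      \<and> ((\<forall>i\<in>{1..k}. integrable M (\<lambda>\<omega>. (dual_norm N (\<eta> i \<omega>))\<^sup>2)) \<longrightarrow>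
          integrable M (\<lambda>\<omega>. f (y k \<omega>) - f xstar) \<and>
          (\<integral>\<omega>. f (y k \<omega>) - f xstar \<partial>M)
            \<le> bregman \<psi> g\<psi> xstar x0 / A_sum a k
              + (\<Sum>i=1..k. (a i)\<^sup>2 * (\<integral>\<omega>. (dual_norm N (\<eta> i \<omega>))\<^sup>2 \<partial>M)) / (\<mu> * A_sum a k))"
proof (intro allI impI)
  fix k :: nat
  assume k: "k \<ge> 1"
  interpret prob_space M
    by fact
  have "X \<noteq> {}"
    using assms(10) by blast
  have \<eta>: "\<And>k. k \<ge> 1 \<Longrightarrow> integrable M (\<eta> k)" "\<And>k. k \<ge> 1 \<Longrightarrow> integral\<^sup>L M (\<eta> k) = 0"
    using assms(18) by blast+
  interpret stochastic_agd N X \<psi> g\<psi> \<mu> f gf L x0 xstar a M \<eta>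
    by unfold_locales (fact assms \<open>X \<noteq> {}\<close> \<eta>)+
  \<comment> \<open>The run is constrained only on \<open>space M\<close>, which suffices for all
    the integrals.\<close>
  have y_eq: "y k \<omega> = Y k \<omega>" if "\<omega> \<in> space M" for \<omega>
    using agd_plus_eq_state[OF assms(19)[OF that] k] by (simp add: Y_def prod_eq_iff)
  have "(\<integral>\<^sup>+\<omega>. ennreal (f (y k \<omega>) - f xstar) \<partial>M) = (\<integral>\<^sup>+\<omega>. ennreal (f (Y k \<omega>) - f xstar) \<partial>M)"
    by (intro nn_integral_cong) (simp add: y_eq)
  moreover have "(\<integral>\<omega>. f (y k \<omega>) - f xstar \<partial>M) = (\<integral>\<omega>. f (Y k \<omega>) - f xstar \<partial>M)"
    by (intro Bochner_Integration.integral_cong) (simp_all add: y_eq)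
  moreover have "integrable M (\<lambda>\<omega>. f (y k \<omega>) - f xstar) \<longleftrightarrow> integrable M (\<lambda>\<omega>. f (Y k \<omega>) - f xstar)"
    by (intro Bochner_Integration.integrable_cong) (simp_all add: y_eq)
  ultimately show "(\<integral>\<^sup>+\<omega>. ennreal (f (y k \<omega>) - f xstar) \<partial>M)
        \<le> ennreal (bregman \<psi> g\<psi> xstar x0 / A_sum a k)
          + (\<Sum>i=1..k. ennreal ((a i)\<^sup>2) * (\<integral>\<^sup>+\<omega>. ennreal ((dual_norm N (\<eta> i \<omega>))\<^sup>2) \<partial>M))
            / ennreal (\<mu> * A_sum a k)
      \<and> ((\<forall>i\<in>{1..k}. integrable M (\<lambda>\<omega>. (dual_norm N (\<eta> i \<omega>))\<^sup>2)) \<longrightarrow>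
          integrable M (\<lambda>\<omega>. f (y k \<omega>) - f xstar) \<and>
          (\<integral>\<omega>. f (y k \<omega>) - f xstar \<partial>M)
            \<le> bregman \<psi> g\<psi> xstar x0 / A_sum a k
              + (\<Sum>i=1..k. (a i)\<^sup>2 * (\<integral>\<omega>. (dual_norm N (\<eta> i \<omega>))\<^sup>2 \<partial>M)) / (\<mu> * A_sum a k))"
    using nn_expected_gap[OF k] expected_gap[OF k] by simp
qed

end
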